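(* Let $c\geqslant 1$ be a real number, $b\geqslant 2$ an integer, and $A\subseteq\mathbb{N}=\{1,2,3,\ldots\}$. Let $A(x)=\#\{a\in A: a\leqslant x\}$, and let $\alpha$ be a real number satisfying $$\alpha<\left(1-\frac{1}{b}+\frac{1}{b(bc-1)}\right)\cdot\frac{\log b}{2}.$$ If $A(x)\leqslant \alpha\cdot \frac{x}{\log x}$ for all sufficiently large $x$, then the real number $\xi_{\mathbb{N}\setminus A,b,c}$ is not simply strongly normal to the base $b$.
   Context: For an integer $m\geqslant 1$, $(m)_b$ denotes the base-$b$ expansion of $m$ (a string of $b$-ary digits) and $\ell_b(m)$ its length. For an infinite set $B=\{a_1<a_2<a_3<\cdots\}\subseteq\mathbb{N}$, define $\xi_{B,b,c}\in(0,1)$ to be the real number whose base-$b$ digit string after the point is the concatenation $$0.\underbrace{(a_1)_b\cdots(a_1)_b}_{}\underbrace{(a_2)_b\cdots(a_2)_b}_{}\underbrace{(a_3)_b\cdots(a_3)_b}_{}\cdots,$$ where each block $(a_n)_b$ is repeated $\lfloor c^{\ell_b(a_n)}\rfloor$ times (blocks in increasing order of $a_n$). For $\xi\in(0,1)$, a digit $k\in\{0,\ldots,b-1\}$ and $n\geqslant1$, let $m_{k,b}(\xi;n)$ be the number of occurrences of $k$ among the first $n$ base-$b$ digits of $\xi$. The number $\xi$ is called simply strongly normal to the base $b$ if for every $k\in\{0,1,\ldots,b-1\}$, $$\limsup_{n\to\infty}\frac{m_{k,b}(\xi;n)-n/b}{\sqrt{2n\log\log n}}=\frac{\sqrt{b-1}}{b}\quad\text{and}\quad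 \liminf_{n\to\infty}\frac{m_{k,b}(\xi;n)-n/b}{\sqrt{2n\log\log n}}=-\frac{\sqrt{b-1}}{b}.$$ *)

theory Defs
  imports Complex_Main "HOL-Library.Infinite_Set" "HOL-Library.Extended_Real" "HOL-Library.Liminf_Limsup"
begin

text \<open>Most significant digit first, no leading zeros. The guard \<open>b < 2\<close> only ensures termination.\<close>

function base_digits :: "nat \<Rightarrow> nat \<Rightarrow> nat list" where
  "base_digits b m =
     (if b < 2 \<or> m = 0 then [] else base_digits b (m div b) @ [m mod b])"
  by auto
termination by (relation "measure snd") auto

declare base_digits.simps [simp del]

definition base_length :: "nat \<Rightarrow> nat \<Rightarrow> nat" where
  "base_length b m = length (base_digits b m)"

definition rep_block :: "nat \<Rightarrow> real \<Rightarrow> nat \<Rightarrow> nat list" where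
  "rep_block b c m =
     concat (replicate (nat \<lfloor>c ^ base_length b m\<rfloor>) (base_digits b m))"

text \<open>The infinite concatenation of the blocks, indexed from 0; \<open>enumerate B n\<close> is the
  element \<open>a\<^sub>n\<^sub>+\<^sub>1\<close> of \<open>B\<close>. For \<open>b \<ge> 2\<close>, \<open>c \<ge> 1\<close> and infinite \<open>B\<close> without 0, every block is
  nonempty, so the first \<open>i + 1\<close> blocks already contain the digit at position \<open>i\<close>.\<close>

definition concat_digit :: "nat set \<Rightarrow> nat \<Rightarrow> real \<Rightarrow> nat \<Rightarrow> nat" where
  "concat_digit B b c i =
     concat (map (\<lambda>n. rep_block b c (enumerate B n)) [0..<Suc i]) ! i"

definition xi :: "nat set \<Rightarrow> nat \<Rightarrow> real \<Rightarrow> real" where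
  "xi B b c = (\<Sum>i. real (concat_digit B b c i) / real b ^ Suc i)"

text \<open>The \<open>i\<close>-th digit after the point, \<open>i \<ge> 1\<close>.\<close>

definition frac_digit :: "nat \<Rightarrow> real \<Rightarrow> nat \<Rightarrow> int" where
  "frac_digit b x i = \<lfloor>x * real b ^ i\<rfloor> mod int b"

definition digit_count :: "nat \<Rightarrow> nat \<Rightarrow> real \<Rightarrow> nat \<Rightarrow> nat" where
  "digit_count k b x n = card {i \<in> {1..n}. frac_digit b x i = int k}"

definition normalized_discrepancy :: "nat \<Rightarrow> nat \<Rightarrow> real \<Rightarrow> nat \<Rightarrow> real" where
  "normalized_discrepancy k b x n =
     (real (digit_count k b x n) - real n / real b) / sqrt (2 * real n * ln (ln (real n)))"

definition simply_strongly_normal :: "nat \<Rightarrow> real \<Rightarrow> bool" where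
  "simply_strongly_normal b x \<longleftrightarrow>
     (\<forall>k\<in>{0..<b}.
        limsup (\<lambda>n. ereal (normalized_discrepancy k b x n)) = ereal (sqrt (real b - 1) / real b) \<and>
        liminf (\<lambda>n. ereal (normalized_discrepancy k b x n)) = ereal (- (sqrt (real b - 1) / real b)))"

end

theory Submission
  imports Defs "HOL-Real_Asymp.Real_Asymp"
begin

text \<open>
  Stop the concatenation after the last element with at most \<open>L\<close> digits and compare the number of
  zeros with its expected value. A number never starts with 0, so without removing anything the
  elements with exactly \<open>L\<close> digits alone contribute \<open>(1 - 1/b) b\<^sup>L\<^sup>-\<^sup>1\<close> missing zeros, each weighted
  by the repetition factor \<open>\<lfloor>c\<^sup>L\<rfloor>\<close>, and the shorter ones never compensate. Removing one element
  reduces this deficit by at most \<open>\<lfloor>c\<^sup>L\<rfloor> L/b\<close>, so removing \<open>A\<close> costs at most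
  \<open>\<lfloor>c\<^sup>L\<rfloor> b\<^sup>L\<^sup>-\<^sup>1 \<alpha> / ln b\<close>. As \<open>\<alpha> < (1 - 1/b) ln b\<close>, a deficit of order \<open>W = \<lfloor>c\<^sup>L\<rfloor> b\<^sup>L\<close> remains
  among \<open>n \<le> L W\<close> digits. This is far larger than \<open>sqrt (n ln ln n)\<close>, and the limit inferior for the
  digit 0 is \<open>-\<infinity>\<close>.
\<close>

section \<open>Base-b expansions and their lengths\<close>

lemma base_digits_0 [simp]: "base_digits b 0 = []"
  by (simp add: base_digits.simps)

lemma base_digits_pos:
  "b \<ge> 2 \<Longrightarrow> m > 0 \<Longrightarrow> base_digits b m = base_digits b (m div b) @ [m mod b]"
  by (subst base_digits.simps) simp

lemma base_digits_less:
  assumes "b \<ge> 2" "d \<in> set (base_digits b m)"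
  shows "d < b"
  using assms(2)
proof (induction m rule: less_induct)
  case (less m)
  show ?case
  proof (cases "m = 0")
    case False
    then have "m div b < m" using assms(1) by simp
    with less False assms(1) show ?thesis
      by (auto simp: base_digits_pos)
  qed (use less in simp)
qed

lemma base_length_le:
  assumes "b \<ge> 2" "m < b ^ L"
  shows "base_length b m \<le> L"
  using assms(2)
proof (induction L arbitrary: m)
  case (Suc L)
  show ?case
  proof (cases "m = 0")
    case False
    have "m div b < b ^ L"
      using Suc.prems by (intro less_mult_imp_div_less) (simp add: mult.commute)
    with Suc.IH[of "m div b"] False assms(1) show ?thesis
      by (simp add: base_length_def base_digits_pos)
  qed (simp add: base_length_def)
qed (simp add: base_length_def)

lemma base_length_gt:
  assumes "b \<ge> 2" "b ^ L \<le> m"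
  shows "L < base_length b m"
  using assms(2)
proof (induction L arbitrary: m)
  case 0
  then show ?case using assms(1) by (simp add: base_length_def base_digits_pos)
next
  case (Suc L)
  have "b ^ L \<le> m div b"
    using Suc.prems assms(1) by (simp add: less_eq_div_iff_mult_less_eq mult.commute)
  moreover have "m > 0"
    using Suc.prems assms(1) by (intro Nat.gr0I) auto
  ultimately show ?case
    using Suc.IH[of "m div b"] assms(1) by (simp add: base_length_def base_digits_pos)
qed

section \<open>Missing zeros of single integers and their sums\<close>

definition zero_deficit :: "nat \<Rightarrow> nat \<Rightarrow> real" where
  "zero_deficit b m = real (base_length b m) / real b - real (count_list (base_digits b m) 0)"

lemma zero_deficit_0 [simp]: "zero_deficit b 0 = 0"
  by (simp add: zero_deficit_def base_length_def)

text \<open>A further digit raises the expected number of zeros by 1/b and the actual number by 1 if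
  it is 0. The case m = r = 0 is excluded because the expansion of 0 is the empty string, not the
  string 0.\<close>

lemma zero_deficit_append_digit:
  assumes "b \<ge> 2" "r < b" "m * b + r > 0"
  shows "zero_deficit b (m * b + r) = zero_deficit b m + 1 / real b - (if r = 0 then 1 else 0)"
proof -
  have "base_digits b (m * b + r) = base_digits b m @ [r]"
    using assms by (subst base_digits_pos) auto
  then show ?thesis
    by (simp add: zero_deficit_def base_length_def add_divide_distrib)
qed

text \<open>Over the b possible last digits the changes cancel: b times 1/b is gained, 1 is lost.
  For m = 0 there is no leading zero to be lost, so 1 - 1/b survives. This is the only source of
  bias in the whole proof.\<close>

lemma sum_zero_deficit_append_digit:
  assumes "b \<ge> 2"
  shows "(\<Sum>r<b. zero_deficit b (m * b + r)) =
           real b * zero_deficit b m + (if m = 0 then (real b - 1) / real b else 0)"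
proof -
  \<comment> \<open>In the corner m = r = 0 the subtracted term is 1/b instead of 1, which makes the
    formula give the deficit 0 of the empty expansion.\<close>
  have "(\<Sum>r<b. zero_deficit b (m * b + r)) =
      (\<Sum>r<b. zero_deficit b m + 1 / real b
         - (if r = 0 then (if m = 0 then 1 / real b else 1) else 0))"
  proof (intro sum.cong refl)
    fix r assume "r \<in> {..<b}"
    then show "zero_deficit b (m * b + r) = zero_deficit b m + 1 / real b
         - (if r = 0 then (if m = 0 then 1 / real b else 1) else 0)"
      using assms zero_deficit_append_digit[of b r m] by (cases "m = 0 \<and> r = 0") auto
  qed
  also have "\<dots> = real b * (zero_deficit b m + 1 / real b) - (if m = 0 then 1 / real b else 1)"
    using assms by (simp add: sum_subtractf sum.delta)
  finally show ?thesis
    using assms by (cases "m = 0") (simp_all add: field_simps)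
qed

text \<open>Group the numbers below b^(l+1) by their quotient modulo the last digit; only the group
  with quotient 0 contributes the extra term.\<close>

lemma sum_zero_deficit_Suc:
  assumes "b \<ge> 2"
  shows "(\<Sum>m<b ^ Suc l. zero_deficit b m) =
           real b * (\<Sum>m<b ^ l. zero_deficit b m) + (real b - 1) / real b"
proof -
  have "(\<Sum>m<b ^ Suc l. zero_deficit b m) =
      (\<Sum>m<b ^ l. \<Sum>k\<in>{m * b..<m * b + b}. zero_deficit b k)"
    by (simp add: sum.nat_group mult.commute)
  also have "\<dots> = (\<Sum>m<b ^ l. \<Sum>r<b. zero_deficit b (m * b + r))"
  proof (rule sum.cong[OF refl])
    fix m
    show "(\<Sum>k\<in>{m * b..<m * b + b}. zero_deficit b k) = (\<Sum>r<b. zero_deficit b (m * b + r))"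
      using sum.shift_bounds_nat_ivl[of "zero_deficit b" 0 "m * b" b]
      by (simp add: lessThan_atLeast0 add.commute)
  qed
  also have "\<dots> = real b * (\<Sum>m<b ^ l. zero_deficit b m)
      + (\<Sum>m<b ^ l. if m = 0 then (real b - 1) / real b else 0)"
    by (simp only: sum_zero_deficit_append_digit[OF assms] sum.distrib sum_distrib_left)
  also have "(\<Sum>m<b ^ l. if m = 0 then (real b - 1) / real b else 0) = (real b - 1) / real b"
    using assms by (simp add: sum.delta)
  finally show ?thesis .
qed

text \<open>The range consists of the numbers with exactly l + 1 digits. The additive constant of
  the recursion cancels in differences, so each such sum is b times the previous one, starting from
  1 - 1/b.\<close>

lemma sum_zero_deficit_base_length:
  assumes "b \<ge> 2"
  shows "(\<Sum>m=b ^ l..<b ^ Suc l. zero_deficit b m) = (real b - 1) / real b * real b ^ l"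
proof -
  have "(\<Sum>m<b ^ Suc l. zero_deficit b m) - (\<Sum>m<b ^ l. zero_deficit b m)
          = (real b - 1) / real b * real b ^ l"
  proof (induction l)
    case 0
    show ?case by (subst sum_zero_deficit_Suc[OF assms]) simp
  next
    case (Suc l)
    have "(\<Sum>m<b ^ Suc (Suc l). zero_deficit b m) - (\<Sum>m<b ^ Suc l. zero_deficit b m)
        = real b * ((\<Sum>m<b ^ Suc l. zero_deficit b m) - (\<Sum>m<b ^ l. zero_deficit b m))"
      using sum_zero_deficit_Suc[OF assms, of "Suc l"] sum_zero_deficit_Suc[OF assms, of l]
      by (simp only: right_diff_distrib)
    also have "\<dots> = (real b - 1) / real b * real b ^ Suc l"
      unfolding Suc by simp
    finally show ?case .
  qed
  moreover have "(\<Sum>m<b ^ Suc l. zero_deficit b m) =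
      (\<Sum>m<b ^ l. zero_deficit b m) + (\<Sum>m=b ^ l..<b ^ Suc l. zero_deficit b m)"
    using assms unfolding lessThan_atLeast0
    by (subst sum.atLeastLessThan_concat) auto
  ultimately show ?thesis by simp
qed

text \<open>The weight is constant on each class of numbers of equal length, and each class has a
  nonnegative total deficit. Hence the longest class alone is a lower bound.\<close>

lemma weighted_sum_zero_deficit_ge:
  fixes w :: "nat \<Rightarrow> real"
  assumes "b \<ge> 2" and "\<And>l. w l \<ge> 0"
  shows "(\<Sum>m<b ^ Suc l. w (base_length b m) * zero_deficit b m)
           \<ge> w (Suc l) * ((real b - 1) / real b * real b ^ l)"
proof -
  have step: "(\<Sum>m<b ^ Suc l. w (base_length b m) * zero_deficit b m) =
      (\<Sum>m<b ^ l. w (base_length b m) * zero_deficit b m)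
      + w (Suc l) * ((real b - 1) / real b * real b ^ l)" for l
  proof -
    have "(\<Sum>m=b ^ l..<b ^ Suc l. w (base_length b m) * zero_deficit b m) =
        (\<Sum>m=b ^ l..<b ^ Suc l. w (Suc l) * zero_deficit b m)"
    proof (intro sum.cong refl)
      fix m assume "m \<in> {b ^ l..<b ^ Suc l}"
      then have "base_length b m = Suc l"
        using base_length_le[OF assms(1), of m "Suc l"] base_length_gt[OF assms(1), of l m] by auto
      then show "w (base_length b m) * zero_deficit b m = w (Suc l) * zero_deficit b m"
        by simp
    qed
    also have "\<dots> = w (Suc l) * ((real b - 1) / real b * real b ^ l)"
      using sum_zero_deficit_base_length[OF assms(1)] by (simp only: flip: sum_distrib_left)
    finally show ?thesis
      using assms(1) unfolding lessThan_atLeast0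
      by (subst sum.atLeastLessThan_concat[symmetric, of 0 "b ^ l"]) auto
  qed
  have "(\<Sum>m<b ^ l. w (base_length b m) * zero_deficit b m) \<ge> 0"
  proof (induction l)
    case (Suc l)
    have "w (Suc l) * ((real b - 1) / real b * real b ^ l) \<ge> 0"
      using assms by (intro mult_nonneg_nonneg divide_nonneg_nonneg) auto
    with Suc step[of l] show ?case by linarith
  qed simp
  with step[of l] show ?thesis by linarith
qed

section \<open>Digits of a convergent series, and initial segments of an enumeration\<close>

lemma count_list_concat: "count_list (concat xss) x = (\<Sum>xs\<leftarrow>xss. count_list xs x)"
  by (induction xss) auto

text \<open>Multiplication by b^(n+1) turns the series into an integer with last digit
  \<open>d n\<close> plus a tail \<open>suminf t\<close>. The floor removes the tail once it lies in
  [0,1); it is strictly below 1 because the digits are not eventually b - 1.\<close>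

lemma frac_digit_suminf:
  fixes d :: "nat \<Rightarrow> nat"
  assumes b: "b \<ge> 2" and less: "\<And>i. d i < b"
    and inf: "\<exists>\<^sub>\<infinity>i. d i \<noteq> b - 1"
  shows "frac_digit b (\<Sum>i. real (d i) / real b ^ Suc i) (Suc n) = int (d n)"
proof -
  define g where "g = (\<lambda>i. real (d i) / real b ^ Suc i)"
  define t where "t = (\<lambda>j. real (d (j + Suc n)) / real b ^ Suc j)"
  have geo: "(\<lambda>j. (real b - 1) / real b ^ Suc j) sums 1"
  proof -
    have "(\<lambda>j. ((real b - 1) / real b) * (1 / real b) ^ j) sums
            (((real b - 1) / real b) * (1 / (1 - 1 / real b)))"
      using b by (intro sums_mult geometric_sums) auto
    also have "((real b - 1) / real b) * (1 / (1 - 1 / real b)) = 1"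
      using b by (simp add: field_simps)
    finally show ?thesis by (simp add: power_divide)
  qed
  have d_le: "real (d i) \<le> real b - 1" for i
    using less[of i] by linarith
  have summable_digits: "summable (\<lambda>i. real (d (i + k)) / real b ^ Suc i)" for k
    by (rule summable_comparison_test'[OF sums_summable[OF geo], of 0])
      (use d_le in \<open>auto intro!: divide_right_mono\<close>)
  have summ_g: "summable g" and summ_t: "summable t"
    using summable_digits[of 0] summable_digits[of "Suc n"] by (simp_all add: g_def t_def)
  have t_nonneg: "suminf t \<ge> 0"
    by (intro suminf_nonneg summ_t) (simp add: t_def)
  have t_less: "suminf t < 1"
  proof -
    \<comment> \<open>A non-maximal digit beyond position n makes the comparison with the geometric
      series of sum 1 strict.\<close>
    obtain j where j: "j \<ge> Suc n" "d j \<noteq> b - 1"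
      using inf unfolding INFM_nat_le by blast
    have "0 < (\<Sum>j. (real b - 1) / real b ^ Suc j - t j)"
    proof (rule suminf_pos2[of _ "j - Suc n"])
      show "summable (\<lambda>j. (real b - 1) / real b ^ Suc j - t j)"
        using summ_t geo by (intro summable_diff) (auto simp: sums_iff)
      show "0 \<le> (real b - 1) / real b ^ Suc i - t i" for i
        using d_le by (auto simp: t_def intro!: divide_right_mono)
      have "real (d j) < real b - 1"
        using less[of j] j(2) by linarith
      then show "0 < (real b - 1) / real b ^ Suc (j - Suc n) - t (j - Suc n)"
        using j(1) b by (auto simp: t_def intro!: divide_strict_right_mono)
    qed
    also have "\<dots> = 1 - suminf t"
      using geo summ_t by (subst suminf_diff[symmetric]) (auto simp: sums_iff)
    finally show ?thesis by simp
  qed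
  \<comment> \<open>The integer formed by the digits before position n; \<open>int b * h\<close>
    vanishes modulo b and leaves \<open>d n\<close>.\<close>
  define h where "h = (\<Sum>i<n. int (d i) * int b ^ (n - Suc i))"
  have "suminf g = (\<Sum>i. g (i + Suc n)) + sum g {..<Suc n}"
    by (rule suminf_split_initial_segment[OF summ_g])
  also have "(\<Sum>i. g (i + Suc n)) = suminf (\<lambda>i. t i * (1 / real b ^ Suc n))"
    by (intro arg_cong[of _ _ suminf] ext) (simp add: g_def t_def power_add)
  also have "\<dots> = suminf t * (1 / real b ^ Suc n)"
    by (rule suminf_mult2[OF summ_t, symmetric])
  finally have "suminf g * real b ^ Suc n = suminf t + sum g {..<Suc n} * real b ^ Suc n"
    using b by (simp add: field_simps)
  also have "sum g {..<Suc n} * real b ^ Suc n = of_int (int b * h + int (d n))"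
  proof -
    have "sum g {..<n} * real b ^ Suc n = (\<Sum>i<n. real b * (real (d i) * real b ^ (n - Suc i)))"
      unfolding sum_distrib_right
    proof (intro sum.cong refl)
      fix i assume "i \<in> {..<n}"
      then have "real b ^ Suc n = real b ^ Suc i * (real b * real b ^ (n - Suc i))"
        by (simp flip: power_add power_Suc)
      then show "g i * real b ^ Suc n = real b * (real (d i) * real b ^ (n - Suc i))"
        using b by (simp add: g_def)
    qed
    also have "\<dots> = of_int (int b * h)"
      by (simp add: h_def sum_distrib_left)
    finally show ?thesis
      using b by (simp add: g_def ring_distribs)
  qed
  finally have "\<lfloor>suminf g * real b ^ Suc n\<rfloor> = int b * h + int (d n)"
    using t_nonneg t_less by (intro floor_unique) auto
  then show ?thesis
    using less[of n] by (simp add: frac_digit_def g_def)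
qed

text \<open>The enumeration is increasing, so the elements below N are cut off at the least index
  whose element reaches N; injectivity identifies that index with the cardinality.\<close>

lemma set_enumerate_below:
  fixes B :: "nat set"
  assumes "infinite B"
  shows "enumerate B ` {..<card {m \<in> B. m < N}} = {m \<in> B. m < N}"
proof -
  have down: "\<exists>n. {m \<in> B. m < N} = enumerate B ` {..<n}"
  proof (intro exI set_eqI iffI)
    let ?n = "LEAST n. N \<le> enumerate B n"
    have ex: "\<exists>n. N \<le> enumerate B n"
      using le_enumerate[OF assms] by blast
    fix m
    {
      assume "m \<in> {m \<in> B. m < N}"
      then obtain k where k: "m = enumerate B k" "m < N"
        using enumerate_Ex[OF assms(1), of m] by auto
      have "k < ?n"
      proof (rule ccontr)
        assume "\<not> k < ?n"
        then have "enumerate B ?n \<le> enumerate B k"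
          using assms by simp
        with LeastI_ex[OF ex] k show False by simp
      qed
      with k show "m \<in> enumerate B ` {..<?n}" by auto
    next
      assume "m \<in> enumerate B ` {..<?n}"
      then obtain k where k: "m = enumerate B k" "k < ?n" by auto
      with not_less_Least[OF k(2)] enumerate_in_set[OF assms]
      show "m \<in> {m \<in> B. m < N}" by auto
    }
  qed
  then obtain n where n: "{m \<in> B. m < N} = enumerate B ` {..<n}" ..
  have "card (enumerate B ` {..<n}) = n"
    using assms by (subst card_image) (auto intro: inj_enumerate inj_on_subset)
  with n show ?thesis by simp
qed

section \<open>The concatenated digit string and the digits of the real number it defines\<close>

locale repeated_concat =
  fixes B :: "nat set" and b :: nat and c :: real
  assumes b: "b \<ge> 2" and c: "c \<ge> 1" and B_pos: "0 \<notin> B" and inf_B: "infinite B"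
begin

abbreviation w :: "nat \<Rightarrow> nat" where
  "w l \<equiv> nat \<lfloor>c ^ l\<rfloor>"

lemma w_mono: "l \<le> l' \<Longrightarrow> w l \<le> w l'"
  using c by (intro nat_mono floor_mono power_increasing)

lemma w_ge_1: "w l \<ge> 1"
  using c one_le_power[of c l] by linarith

definition prefix_digits :: "nat \<Rightarrow> nat list" where
  "prefix_digits n = concat (map (\<lambda>n. rep_block b c (enumerate B n)) [0..<n])"

lemma prefix_digits_Suc:
  "prefix_digits (Suc n) = prefix_digits n @ rep_block b c (enumerate B n)"
  by (simp add: prefix_digits_def)

lemma enumerate_B_pos: "enumerate B n > 0"
  using enumerate_in_set[OF inf_B, of n] B_pos by (metis gr0I)

lemma length_rep_block: "length (rep_block b c m) = w (base_length b m) * base_length b m"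
  by (simp add: rep_block_def length_concat sum_list_replicate base_length_def)

lemma count_rep_block:
  "count_list (rep_block b c m) k = w (base_length b m) * count_list (base_digits b m) k"
  by (simp add: rep_block_def count_list_concat sum_list_replicate)

lemma length_prefix_digits_Suc: "length (prefix_digits n) < length (prefix_digits (Suc n))"
proof -
  have "base_length b (enumerate B n) > 0"
    using b enumerate_B_pos[of n] by (intro base_length_gt) auto
  then show ?thesis
    using w_ge_1[of "base_length b (enumerate B n)"]
    by (simp add: prefix_digits_Suc length_rep_block del: zero_less_nat_eq zero_less_floor)
qed

lemma length_prefix_digits_ge: "n \<le> length (prefix_digits n)"
proof (induction n)
  case (Suc n)
  with length_prefix_digits_Suc[of n] show ?case by simp
qed simp

lemma prefix_digits_append: "n \<le> n' \<Longrightarrow> \<exists>xs. prefix_digits n' = prefix_digits n @ xs"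
  by (induction n' rule: dec_induct) (auto simp: prefix_digits_Suc)

text \<open>Of two prefixes made of whole blocks one extends the other, so they agree wherever both
  are defined. This frees the digit at i from the particular choice of i + 1 blocks in
  \<open>concat_digit\<close>.\<close>

lemma concat_digit_eq:
  assumes "i < length (prefix_digits n)"
  shows "concat_digit B b c i = prefix_digits n ! i"
proof -
  have i: "i < length (prefix_digits (Suc i))"
    using length_prefix_digits_ge[of "Suc i"] by simp
  have "concat_digit B b c i = prefix_digits (Suc i) ! i"
    by (simp only: concat_digit_def prefix_digits_def)
  also have "\<dots> = prefix_digits n ! i"
    using prefix_digits_append[of "Suc i" n] prefix_digits_append[of n "Suc i"] i assms
    by (cases "Suc i \<le> n") (auto simp: nth_append)
  finally show ?thesis .
qed

lemma concat_digit_less: "concat_digit B b c i < b"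
proof -
  have i: "i < length (prefix_digits (Suc i))"
    using length_prefix_digits_ge[of "Suc i"] by simp
  then have "concat_digit B b c i \<in> set (prefix_digits (Suc i))"
    using concat_digit_eq[OF i] by simp
  then show ?thesis
    using base_digits_less[OF b] by (auto simp: prefix_digits_def rep_block_def)
qed

text \<open>The block of a multiple of b ends in the digit 0. Infinitely many such blocks rule out a
  tail of digits b - 1, as \<open>frac_digit_suminf\<close> requires.\<close>

lemma INFM_concat_digit_eq_0:
  assumes "infinite {m \<in> B. b dvd m}"
  shows "\<exists>\<^sub>\<infinity>i. concat_digit B b c i = 0"
  unfolding INFM_nat_le
proof
  fix k
  obtain m where m: "m \<in> B" "b dvd m" "m > enumerate B k"
    using assms unfolding infinite_nat_iff_unbounded by blast
  then obtain n where n: "enumerate B n = m"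
    using enumerate_Ex[OF inf_B] by auto
  have "k < n"
    using m(3) n inf_B by (metis enumerate_mono_iff)
  define i where "i = length (prefix_digits (Suc n)) - 1"
  have less: "i < length (prefix_digits (Suc n))"
    using length_prefix_digits_Suc[of n] by (simp add: i_def)
  have "k \<le> i"
    using length_prefix_digits_ge[of "Suc n"] \<open>k < n\<close> by (simp add: i_def)
  have "m > 0" using m B_pos by (metis gr0I)
  \<comment> \<open>Splitting off the last copy of the expansion, and then its last digit, exhibits
    the final 0 at position i.\<close>
  have "prefix_digits (Suc n) = prefix_digits n
      @ concat (replicate (w (base_length b m) - 1) (base_digits b m))
      @ base_digits b (m div b) @ [0]"
  proof -
    have "w (base_length b m) = Suc (w (base_length b m) - 1)"
      using w_ge_1[of "base_length b m"] by linarith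
    then have "rep_block b c m =
        concat (replicate (w (base_length b m) - 1) (base_digits b m)) @ base_digits b m"
      unfolding rep_block_def
      by (metis append_Nil2 concat.simps concat_append replicate_Suc replicate_append_same)
    moreover have "base_digits b m = base_digits b (m div b) @ [0]"
      using b \<open>m > 0\<close> m(2) by (simp add: base_digits_pos)
    ultimately show ?thesis by (simp add: prefix_digits_Suc n)
  qed
  then have "last (prefix_digits (Suc n)) = 0" by simp
  then have "prefix_digits (Suc n) ! i = 0"
    using less by (subst (asm) last_conv_nth) (auto simp: i_def)
  with concat_digit_eq[OF less] \<open>k \<le> i\<close> show "\<exists>i\<ge>k. concat_digit B b c i = 0"
    by auto
qed

text \<open>Transfers counting from the real number to the string. The image under
  \<open>Suc\<close> reconciles positions after the point, counted from 1, with list indices,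
  counted from 0.\<close>

lemma digit_count_prefix_digits:
  assumes "infinite {m \<in> B. b dvd m}"
  shows "digit_count k b (xi B b c) (length (prefix_digits n)) = count_list (prefix_digits n) k"
proof -
  have frac: "frac_digit b (xi B b c) (Suc i) = int (concat_digit B b c i)" for i
    unfolding xi_def
    using b concat_digit_less INFM_concat_digit_eq_0[OF assms]
    by (intro frac_digit_suminf) (auto elim!: INFM_mono)
  have "{i \<in> {1..length (prefix_digits n)}. frac_digit b (xi B b c) i = int k} =
      Suc ` {i. i < length (prefix_digits n) \<and> prefix_digits n ! i = k}"
  proof (intro set_eqI)
    fix i
    show "i \<in> {i \<in> {1..length (prefix_digits n)}. frac_digit b (xi B b c) i = int k} \<longleftrightarrow>
        i \<in> Suc ` {i. i < length (prefix_digits n) \<and> prefix_digits n ! i = k}"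
      by (cases i) (auto simp: frac Suc_le_eq concat_digit_eq[of _ n])
  qed
  then have "digit_count k b (xi B b c) (length (prefix_digits n)) =
      card {i. i < length (prefix_digits n) \<and> prefix_digits n ! i = k}"
    by (simp add: digit_count_def card_image)
  also have "\<dots> = count_list (prefix_digits n) k"
    by (simp add: count_list_eq_length_filter length_filter_conv_card eq_commute)
  finally show ?thesis .
qed

lemma sum_list_enumerate_below:
  fixes f :: "nat \<Rightarrow> 'a::comm_monoid_add"
  shows "(\<Sum>n\<leftarrow>[0..<card {m \<in> B. m < N}]. f (enumerate B n)) = (\<Sum>m\<in>{m \<in> B. m < N}. f m)"
proof -
  have "(\<Sum>n\<leftarrow>[0..<card {m \<in> B. m < N}]. f (enumerate B n)) =
      (\<Sum>n<card {m \<in> B. m < N}. f (enumerate B n))"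
    by (simp add: sum_list_distinct_conv_sum_set lessThan_atLeast0)
  also have "\<dots> = (\<Sum>m\<in>enumerate B ` {..<card {m \<in> B. m < N}}. f m)"
    using inf_B by (subst sum.reindex) (auto intro: inj_enumerate inj_on_subset)
  finally show ?thesis
    by (simp add: set_enumerate_below[OF inf_B])
qed

section \<open>Length and missing zeros of the prefix formed by the elements below a bound\<close>

definition digits_below :: "nat \<Rightarrow> nat list" where
  "digits_below N = prefix_digits (card {m \<in> B. m < N})"

lemma length_digits_below:
  "length (digits_below N) = (\<Sum>m\<in>{m \<in> B. m < N}. w (base_length b m) * base_length b m)"
  unfolding digits_below_def prefix_digits_def
  by (simp add: length_concat comp_def length_rep_block flip: sum_list_enumerate_below)

lemma count_digits_below:
  "count_list (digits_below N) k =
     (\<Sum>m\<in>{m \<in> B. m < N}. w (base_length b m) * count_list (base_digits b m) k)"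
  unfolding digits_below_def prefix_digits_def
  by (simp add: count_list_concat comp_def count_rep_block flip: sum_list_enumerate_below)

lemma length_digits_below_le:
  "length (digits_below (b ^ L)) \<le> L * (w L * b ^ L)"
proof -
  have "length (digits_below (b ^ L)) \<le> (\<Sum>m\<in>{m \<in> B. m < b ^ L}. w L * L)"
    unfolding length_digits_below
    by (intro sum_mono mult_le_mono w_mono) (auto simp: base_length_le[OF b])
  also have "\<dots> = card {m \<in> B. m < b ^ L} * (w L * L)" by simp
  also have "card {m \<in> B. m < b ^ L} \<le> b ^ L"
    using card_mono[of "{..<b ^ L}" "{m \<in> B. m < b ^ L}"] by auto
  finally show ?thesis by (simp add: mult_ac)
qed

lemma zero_deficit_digits_below:
  "real (length (digits_below N)) / real b - real (count_list (digits_below N) 0) =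
     (\<Sum>m\<in>{m \<in> B. m < N}. real (w (base_length b m)) * zero_deficit b m)"
  by (simp add: length_digits_below count_digits_below zero_deficit_def sum_divide_distrib
      sum_subtractf ring_distribs)

text \<open>Sum over all integers below b^(l+1), then subtract the integers missing from B. A
  missing integer takes away at most its weighted length divided by b, the extreme case being an
  expansion without zeros.\<close>

lemma zero_deficit_digits_below_ge:
  "real (length (digits_below (b ^ Suc l))) / real b - real (count_list (digits_below (b ^ Suc l)) 0)
     \<ge> real (w (Suc l)) * ((real b - 1) / real b * real b ^ l
          - real (Suc l) / real b * real (card {m \<in> {1..} - B. m < b ^ Suc l}))"
proof -
  let ?g = "\<lambda>m. real (w (base_length b m)) * zero_deficit b m"
  let ?A = "{m \<in> {1..} - B. m < b ^ Suc l}"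
  \<comment> \<open>The integer 0 lies neither in B nor in \<open>?A\<close>, but its deficit is
    0.\<close>
  have "(\<Sum>m<b ^ Suc l. ?g m) = (\<Sum>m\<in>{m \<in> B. m < b ^ Suc l} \<union> ?A. ?g m)"
  proof (rule sum.mono_neutral_right)
    show "\<forall>i\<in>{..<b ^ Suc l} - ({m \<in> B. m < b ^ Suc l} \<union> ?A). ?g i = 0"
    proof
      fix i assume "i \<in> {..<b ^ Suc l} - ({m \<in> B. m < b ^ Suc l} \<union> ?A)"
      then have "i = 0" by auto
      then show "?g i = 0" by simp
    qed
  qed auto
  also have "\<dots> = (\<Sum>m\<in>{m \<in> B. m < b ^ Suc l}. ?g m) + (\<Sum>m\<in>?A. ?g m)"
    by (intro sum.union_disjoint) auto
  finally have split: "(\<Sum>m\<in>{m \<in> B. m < b ^ Suc l}. ?g m) =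
      (\<Sum>m<b ^ Suc l. ?g m) - (\<Sum>m\<in>?A. ?g m)" by simp
  have "(\<Sum>m\<in>?A. ?g m) \<le> (\<Sum>m\<in>?A. real (w (Suc l)) * (real (Suc l) / real b))"
  proof (intro sum_mono)
    fix m assume "m \<in> ?A"
    then have len: "base_length b m \<le> Suc l" by (intro base_length_le[OF b]) auto
    have "?g m \<le> real (w (base_length b m)) * (real (base_length b m) / real b)"
      by (intro mult_left_mono) (auto simp: zero_deficit_def)
    also have "\<dots> \<le> real (w (Suc l)) * (real (Suc l) / real b)"
      using len w_mono[OF len] by (intro mult_mono divide_right_mono) auto
    finally show "?g m \<le> real (w (Suc l)) * (real (Suc l) / real b)" .
  qed
  moreover have "(\<Sum>m<b ^ Suc l. ?g m) \<ge> real (w (Suc l)) * ((real b - 1) / real b * real b ^ l)"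
    using b by (intro weighted_sum_zero_deficit_ge) auto
  ultimately show ?thesis
    unfolding zero_deficit_digits_below split by (simp add: right_diff_distrib mult_ac)
qed

end

section \<open>Sparsity of the removed set, and deficits too large for strong normality\<close>

text \<open>Otherwise A would contain all but K multiples of b, hence at least n - K elements up to
  bn, while the hypothesis allows only O(n / ln n).\<close>

lemma infinite_multiples_complement:
  fixes A :: "nat set" and \<alpha> :: real
  assumes b: "b \<ge> 2"
    and bound: "\<forall>\<^sub>F x :: real in at_top. real (card {a \<in> A. real a \<le> x}) \<le> \<alpha> * (x / ln x)"
  shows "infinite {m \<in> {1..} - A. b dvd m}"
proof
  assume fin: "finite {m \<in> {1..} - A. b dvd m}" (is "finite ?F")
  define \<beta> where "\<beta> = real b"
  define K where "K = real (card ?F)"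
  have \<beta>: "\<beta> > 0" using b by (simp add: \<beta>_def)
  have "filterlim (\<lambda>n::nat. \<beta> * real n) at_top sequentially"
    using \<beta> by real_asymp
  from eventually_compose_filterlim[OF bound this]
  have "\<forall>\<^sub>F n in sequentially.
      real (card {a \<in> A. real a \<le> \<beta> * real n}) \<le> \<alpha> * (\<beta> * real n / ln (\<beta> * real n))" .
  moreover have "\<forall>\<^sub>F n in sequentially. \<alpha> * (\<beta> * real n / ln (\<beta> * real n)) + K < real n"
  proof -
    \<comment> \<open>The claim divided by n: both terms on the left tend to 0.\<close>
    have "(\<lambda>n::nat. \<alpha> * (\<beta> * (1 / ln (\<beta> * real n))) + K * (1 / real n)) \<longlonglongrightarrow> \<alpha> * (\<beta> * 0) + K * 0"
      by (intro tendsto_intros) (use \<beta> in real_asymp)+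
    then have "\<forall>\<^sub>F n in sequentially. \<alpha> * (\<beta> * (1 / ln (\<beta> * real n))) + K * (1 / real n) < 1"
      by (rule order_tendstoD) simp
    with eventually_gt_at_top[of 0] show ?thesis
    proof eventually_elim
      case (elim n)
      then have "(\<alpha> * (\<beta> * (1 / ln (\<beta> * real n))) + K * (1 / real n)) * real n < 1 * real n"
        by (intro mult_strict_right_mono) auto
      with elim show ?case by (simp add: ring_distribs mult_ac)
    qed
  qed
  ultimately have "\<forall>\<^sub>F n in sequentially. False"
  proof eventually_elim
    case (elim n)
    let ?A = "{a \<in> A. real a \<le> \<beta> * real n}"
    have fin_A: "finite ?A"
      by (rule finite_subset[of _ "{..b * n}"]) (auto simp: \<beta>_def simp flip: of_nat_mult)
    have "(\<lambda>j. b * j) ` {1..n} \<subseteq> ?A \<union> ?F"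
      using b by (auto simp: \<beta>_def Suc_le_eq)
    then have "card ((\<lambda>j. b * j) ` {1..n}) \<le> card (?A \<union> ?F)"
      using fin fin_A by (intro card_mono) auto
    also have "\<dots> \<le> card ?A + card ?F" by (rule card_Un_le)
    also have "card ((\<lambda>j. b * j) ` {1..n}) = n"
      using b by (subst card_image) (auto simp: inj_on_def)
    finally have "real n \<le> real (card ?A) + K" by (simp add: K_def)
    with elim show ?case by linarith
  qed
  then show False by simp
qed

text \<open>A finite limit inferior for the digit 0 keeps the deficit below n^(3/5) eventually. With
  n at most L W this gives \<delta> W < (L W)^(3/5), that is \<delta>^5 W^2 < L^3, which contradicts
  the exponential growth of W.\<close>

lemma not_simply_strongly_normal_if_zero_deficit:
  fixes n :: "nat \<Rightarrow> nat" and W :: "nat \<Rightarrow> real"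
  assumes "\<delta> > 0" and "b > 0"
    and deficit: "\<forall>\<^sub>F L in sequentially.
      \<delta> * W L \<le> real (n L) / real b - real (digit_count 0 b x (n L))"
    and len: "\<forall>\<^sub>F L in sequentially. real (n L) \<le> real L * W L"
    and W: "\<And>L. W L \<ge> 2 ^ L"
  shows "\<not> simply_strongly_normal b x"
proof
  assume "simply_strongly_normal b x"
  then have lim: "liminf (\<lambda>n. ereal (normalized_discrepancy 0 b x n)) =
      ereal (- (sqrt (real b - 1) / real b))"
    using \<open>b > 0\<close> by (auto simp: simply_strongly_normal_def)
  \<comment> \<open>Adding 1 makes K positive and puts -K strictly below the limit inferior.\<close>
  define K where "K = \<bar>sqrt (real b - 1) / real b\<bar> + 1"
  have K: "K > 0" by (simp add: K_def add_nonneg_pos)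
  have "ereal (- K) < liminf (\<lambda>n. ereal (normalized_discrepancy 0 b x n))"
    unfolding lim K_def by (simp add: abs_if)
  then have "\<forall>\<^sub>F n in sequentially. - K < normalized_discrepancy 0 b x n"
    by (drule_tac less_LiminfD) simp
  moreover have "\<forall>\<^sub>F n in sequentially. sqrt (2 * real n * ln (ln (real n))) > 0"
    by real_asymp
  \<comment> \<open>Any exponent strictly between 1/2 and 1 absorbs the iterated logarithm and still
    loses against W; with 3/5 a fifth power clears the fractions.\<close>
  moreover have "\<forall>\<^sub>F n in sequentially.
      K * sqrt (2 * real n * ln (ln (real n))) \<le> real n powr (3 / 5)"
    using K by real_asymp
  ultimately have "\<forall>\<^sub>F n in sequentially.
      real n / real b - real (digit_count 0 b x n) < real n powr (3 / 5)"
  proof eventually_elim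
    case (elim n)
    from elim(1,2) have "- K * sqrt (2 * real n * ln (ln (real n))) <
        real (digit_count 0 b x n) - real n / real b"
      unfolding normalized_discrepancy_def by (simp add: pos_less_divide_eq)
    with elim(3) show ?case by simp
  qed
  \<comment> \<open>The deficit is at most \<open>real (n L) / real b\<close>, so its exponential
    lower bound forces n L to infinity.\<close>
  moreover have "filterlim n at_top sequentially"
  proof -
    have "filterlim (\<lambda>L. \<delta> * 2 ^ L) at_top sequentially"
      using \<open>\<delta> > 0\<close> by real_asymp
    moreover have "\<forall>\<^sub>F L in sequentially. \<delta> * 2 ^ L \<le> real (n L)"
      using deficit
    proof eventually_elim
      case (elim L)
      have "\<delta> * 2 ^ L \<le> \<delta> * W L"
        using W \<open>\<delta> > 0\<close> by (intro mult_left_mono) auto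
      also have "\<dots> \<le> real (n L) / real b" using elim by simp
      also have "\<dots> \<le> real (n L)" using \<open>b > 0\<close> divide_left_mono[of 1 "real b" "real (n L)"] by simp
      finally show ?case .
    qed
    ultimately have "filterlim (\<lambda>L. real (n L)) at_top sequentially"
      by (rule filterlim_at_top_mono)
    then show ?thesis by (simp add: filterlim_sequentially_iff_filterlim_real)
  qed
  ultimately have "\<forall>\<^sub>F L in sequentially.
      real (n L) / real b - real (digit_count 0 b x (n L)) < real (n L) powr (3 / 5)"
    by (rule eventually_compose_filterlim)
  moreover have "\<forall>\<^sub>F L in sequentially. real L ^ 3 < \<delta> ^ 5 * (2 ^ L) ^ 2"
    using \<open>\<delta> > 0\<close> by real_asymp
  ultimately have "\<forall>\<^sub>F L in sequentially. False"
    using deficit len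
  proof eventually_elim
    case (elim L)
    have W_pos: "W L > 0"
      using W[of L] by (rule less_le_trans[rotated]) simp
    have "\<delta> * W L < real (n L) powr (3 / 5)" using elim by linarith
    also have "\<dots> \<le> (real L * W L) powr (3 / 5)" using elim by (intro powr_mono2) auto
    finally have "(\<delta> * W L) ^ 5 < ((real L * W L) powr (3 / 5)) ^ 5"
      using W_pos \<open>\<delta> > 0\<close> by (intro power_strict_mono) auto
    also have "\<dots> = (real L * W L) ^ 3"
    proof (cases "L = 0")
      case False
      with W_pos show ?thesis
        using powr_power[of "real L * W L" "3 / 5" 5] by simp
    qed simp
    finally have "(\<delta> ^ 5 * W L ^ 2) * W L ^ 3 < real L ^ 3 * W L ^ 3"
      by (simp add: power_mult_distrib mult.assoc flip: power_add)
    then have "\<delta> ^ 5 * W L ^ 2 < real L ^ 3"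
      using W_pos by simp
    moreover have "\<delta> ^ 5 * (2 ^ L) ^ 2 \<le> \<delta> ^ 5 * W L ^ 2"
      using W \<open>\<delta> > 0\<close> by (intro mult_left_mono power_mono) auto
    ultimately show ?case using elim by linarith
  qed
  then show False by simp
qed

section \<open>Combining the estimates along the prefixes of elements below b^L\<close>

theorem theorem1p2:
  fixes c \<alpha> :: real and b :: nat and A :: "nat set"
  assumes "c \<ge> 1" and "b \<ge> 2" and "A \<subseteq> {1..}"
    and "\<alpha> < (1 - 1 / real b + 1 / (real b * (real b * c - 1))) * (ln (real b) / 2)"
    and "\<forall>\<^sub>F x :: real in at_top. real (card {a \<in> A. real a \<le> x}) \<le> \<alpha> * (x / ln x)"
  shows "\<not> simply_strongly_normal b (xi ({1..} - A) b c)"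
proof -
  have inf: "infinite {m \<in> {1..} - A. b dvd m}"
    by (rule infinite_multiples_complement[OF assms(2,5)])
  have "infinite ({1..} - A)"
    using inf by (rule infinite_super[rotated]) auto
  then interpret repeated_concat "{1..} - A" b c
    using assms(1,2) by unfold_locales auto
  \<comment> \<open>The gain 1 - 1/b from absent leading zeros minus the cost \<alpha> / ln b of
    removing A. The outer division by b arises because \<open>W\<close> carries b^L where the
    deficit carries b^(L-1).\<close>
  define \<delta> where "\<delta> = ((real b - 1) / real b - \<alpha> / ln (real b)) / real b"
  define W where "W = (\<lambda>L. real (w L) * real b ^ L)"
  define n where "n = (\<lambda>L. length (digits_below (b ^ L)))"
  have ln_b: "ln (real b) > 0" using b by simp
  have "\<delta> > 0"
  proof -
    have "real b * c \<ge> real b * 1"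
      using assms(1) by (intro mult_left_mono) auto
    then have "real b * c - 1 \<ge> 1" using b by linarith
    \<comment> \<open>Since bc - 1 is at least 1 and b at least 2, the correction term is at most
      1/b and so at most 1 - 1/b. The assumed bound on \<alpha> is therefore at most (1 - 1/b) ln
      b.\<close>
    then have "1 / (real b * (real b * c - 1)) \<le> 1 / (real b * 1)"
      using b by (intro divide_left_mono mult_left_mono mult_pos_pos) auto
    also have "1 / (real b * 1) \<le> 1 - 1 / real b"
      using b by (simp add: field_simps)
    finally have "(1 - 1 / real b + 1 / (real b * (real b * c - 1))) * (ln (real b) / 2) \<le>
        (2 * (1 - 1 / real b)) * (ln (real b) / 2)"
      using ln_b by (intro mult_right_mono) auto
    also have "\<dots> = (1 - 1 / real b) * ln (real b)" by simp
    finally have "\<alpha> < (1 - 1 / real b) * ln (real b)" using assms(4) by linarith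
    then have "\<alpha> / ln (real b) < (real b - 1) / real b"
      using ln_b b by (simp add: divide_less_eq diff_divide_distrib)
    then show ?thesis using b by (simp add: \<delta>_def)
  qed
  show ?thesis
  proof (rule not_simply_strongly_normal_if_zero_deficit[OF \<open>\<delta> > 0\<close>, of _ W n])
    show "b > 0" using b by simp
    show "W L \<ge> 2 ^ L" for L
    proof -
      have "1 * 2 ^ L \<le> W L"
        unfolding W_def using w_ge_1[of L] b by (intro mult_mono power_mono) auto
      then show ?thesis by simp
    qed
    show "\<forall>\<^sub>F L in sequentially. real (n L) \<le> real L * W L"
      using length_digits_below_le
      by (auto simp: n_def W_def simp flip: of_nat_mult of_nat_power)
    \<comment> \<open>The counting hypothesis is applied only at x = b^L, where ln x = L ln
      b.\<close>
    have "filterlim (\<lambda>L. real b ^ L) at_top sequentially"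
      using b by real_asymp
    from eventually_compose_filterlim[OF assms(5) this] eventually_gt_at_top[of 0]
    show "\<forall>\<^sub>F L in sequentially.
        \<delta> * W L \<le> real (n L) / real b - real (digit_count 0 b (xi ({1..} - A) b c) (n L))"
    proof eventually_elim
      case (elim L)
      then obtain l where L: "L = Suc l" by (auto simp: gr0_conv_Suc)
      have "card {m \<in> {1..} - ({1..} - A). m < b ^ L} \<le> card {a \<in> A. real a \<le> real b ^ L}"
        by (intro card_mono finite_subset[of "{a \<in> A. real a \<le> real b ^ L}" "{..b ^ L}"])
          (auto simp flip: of_nat_power)
      then have "real (card {m \<in> {1..} - ({1..} - A). m < b ^ L}) \<le>
          \<alpha> * (real b ^ L / (real L * ln (real b)))"
        using elim b by (simp add: ln_realpow)
      then have "real L / real b * real (card {m \<in> {1..} - ({1..} - A). m < b ^ L}) \<le>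
          real L / real b * (\<alpha> * (real b ^ L / (real L * ln (real b))))"
        by (intro mult_left_mono) auto
      \<comment> \<open>The length factor L cancels against ln (b^L), leaving a cost of the same
        order b^l as the gain.\<close>
      also have "\<dots> = \<alpha> / ln (real b) * real b ^ l"
        using b elim by (simp add: L)
      finally have "real (w L) * (((real b - 1) / real b - \<alpha> / ln (real b)) * real b ^ l) \<le>
          real (w L) * ((real b - 1) / real b * real b ^ l
          - real L / real b * real (card {m \<in> {1..} - ({1..} - A). m < b ^ L}))"
        by (intro mult_left_mono) (auto simp: left_diff_distrib)
      also have "\<dots> \<le> real (n L) / real b - real (count_list (digits_below (b ^ L)) 0)"
        using zero_deficit_digits_below_ge[of l] by (simp only: L n_def)
      also have "count_list (digits_below (b ^ L)) 0 =
          digit_count 0 b (xi ({1..} - A) b c) (n L)"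
        unfolding n_def digits_below_def by (rule digit_count_prefix_digits[OF inf, symmetric])
      also have "real (w L) * (((real b - 1) / real b - \<alpha> / ln (real b)) * real b ^ l) = \<delta> * W L"
        using b by (simp add: \<delta>_def W_def L)
      finally show ?case .
    qed
  qed
qed

end
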